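(* Let $n\ge 1$ be an integer, let $A$ be an affine polynomial on $\mathbb{R}^n$ and let $\lambda>0$ be such that $A(0,\ldots,0)=1$ and such that the Taylor expansion $$\left(A(z_1,\ldots,z_n)\right)^{-\lambda}=\sum_{\boldsymbol{\alpha}\in\mathbb{N}^n}c_{\boldsymbol{\alpha}}(\lambda)\,z_1^{\alpha_1}\cdots z_n^{\alpha_n}$$ satisfies $c_{\boldsymbol{\alpha}}(\lambda)>0$ for all $\boldsymbol{\alpha}\in\mathbb{N}^n$. Let $\mu_\lambda=\sum_{\boldsymbol{\alpha}\in\mathbb{N}^n}c_{\boldsymbol{\alpha}}(\lambda)\delta_{\boldsymbol{\alpha}}$ and $$D(\mu_\lambda)=\left\{\boldsymbol{\theta}\in\mathbb{R}^n:\ \sum_{\boldsymbol{\alpha}\in\mathbb{N}^n}c_{\boldsymbol{\alpha}}(\lambda)\,e^{\theta_1\alpha_1+\cdots+\theta_n\alpha_n}<+\infty\right\}.$$ Denote $H=\{\mathbf{s}\in\mathbb{R}^n:\ s_1+\cdots+s_n=0\}$. For $\mathbf{s}\in H$, denote by $R_{\mathbf{s}}$ the smallest positive zero of the polynomial $P_{\mathbf{s}}(t)=A(te^{s_1},\ldots,te^{s_n})$. Then the map $\mathbf{s}\mapsto \mathbf{s}+\log R_{\mathbf{s}}\,(1,\ldots,1)$ is a parametrization by $H$ of a hypersurface in $\mathbb{R}^n$ which is the boundary of $D(\mu_\lambda)$. More specifically, if $\boldsymbol{\theta}\in\mathbb{R}^n$, if $\overline{\theta}_n=\frac1n(\theta_1+\cdots+\theta_n)$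 and if $\mathbf{s}=\boldsymbol{\theta}-\overline{\theta}_n(1,\ldots,1)$, then $\boldsymbol{\theta}\in D(\mu_\lambda)$ if and only if $\overline{\theta}_n<\log R_{\mathbf{s}}$. Finally, $D(\mu_\lambda)$ is an open set.
   Context: $\mathbb{N}$ is the set of nonnegative integers. An affine polynomial in $z_1,\ldots,z_n$ is a polynomial that is affine with respect to each variable $z_j$, i.e. $\partial^2 A/\partial z_j^2=0$ for all $j=1,\ldots,n$; that is, $A(\mathbf{z})=\sum_{T\subset\{1,\ldots,n\}}a_T\prod_{i\in T}z_i$ with real coefficients $a_T$. The Taylor expansion of $A^{-\lambda}$ is taken at the origin, where $A$ equals $1$. $\delta_{\boldsymbol{\alpha}}$ is the Dirac mass at $\boldsymbol{\alpha}$, so $\mu_\lambda$ is a discrete measure on $\mathbb{N}^n$, and the convex set $D(\mu_\lambda)$ is the domain of existence of its Laplace transform. *)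

theory Defs
  imports "HOL-Analysis.Analysis"
begin

text \<open>
  Points of $\mathbb{R}^n$ are vectors of type \<^typ>\<open>real ^ 'n\<close> with $n$ the cardinality of \<open>'n\<close>;
  multi-indices in $\mathbb{N}^n$ are functions of type \<^typ>\<open>'n \<Rightarrow> nat\<close>.
\<close>

definition affine_polynomial :: "(real ^ 'n \<Rightarrow> real) \<Rightarrow> bool" where
  "affine_polynomial A \<longleftrightarrow>
     (\<exists>a :: 'n set \<Rightarrow> real. \<forall>z. A z = (\<Sum>T\<in>UNIV. a T * (\<Prod>i\<in>T. z $ i)))"

text \<open>
  The multivariate counterpart of \<^const>\<open>has_fps_expansion\<close>: \<open>c\<close> is the family of Taylor
  coefficients of \<open>f\<close> at the origin. Such a \<open>c\<close> is unique, and it exists iff \<open>f\<close> is real-analytic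
  near the origin.
\<close>

definition has_taylor_expansion :: "(real ^ 'n \<Rightarrow> real) \<Rightarrow> (('n \<Rightarrow> nat) \<Rightarrow> real) \<Rightarrow> bool" where
  "has_taylor_expansion f c \<longleftrightarrow>
     (\<forall>\<^sub>F z in nhds 0. ((\<lambda>\<alpha>. c \<alpha> * (\<Prod>i\<in>UNIV. z $ i ^ \<alpha> i)) has_sum f z) UNIV)"

definition coeff_measure :: "(('n \<Rightarrow> nat) \<Rightarrow> real) \<Rightarrow> ('n \<Rightarrow> nat) measure" where
  "coeff_measure c = point_measure UNIV (\<lambda>\<alpha>. ennreal (c \<alpha>))"

definition laplace_domain :: "('n::finite \<Rightarrow> nat) measure \<Rightarrow> (real ^ 'n) set" where
  "laplace_domain \<mu> =
     {\<theta>. (\<integral>\<^sup>+ \<alpha>. ennreal (exp (\<Sum>i\<in>UNIV. \<theta> $ i * real (\<alpha> i))) \<partial>\<mu>) < \<infinity>}"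

text \<open>For the measure with atoms \<open>c \<alpha>\<close>, the Laplace transform is the series
  $\sum_\alpha c_\alpha e^{\theta_1\alpha_1+\cdots+\theta_n\alpha_n}$.\<close>

lemma laplace_domain_coeff_measure:
  fixes c :: "('n::finite \<Rightarrow> nat) \<Rightarrow> real"
  assumes "\<And>\<alpha>. c \<alpha> \<ge> 0"
  shows "laplace_domain (coeff_measure c) =
    {\<theta>. (\<lambda>\<alpha>. c \<alpha> * exp (\<Sum>i\<in>UNIV. \<theta> $ i * real (\<alpha> i))) summable_on UNIV}"
proof -
  have "(\<integral>\<^sup>+ \<alpha>. ennreal (exp (\<Sum>i\<in>UNIV. \<theta> $ i * real (\<alpha> i))) \<partial>coeff_measure c) < \<infinity> \<longleftrightarrow>
      (\<lambda>\<alpha>. c \<alpha> * exp (\<Sum>i\<in>UNIV. \<theta> $ i * real (\<alpha> i))) summable_on UNIV" for \<theta> :: "real ^ 'n"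
  proof -
    let ?f = "\<lambda>\<alpha>. c \<alpha> * exp (\<Sum>i\<in>UNIV. \<theta> $ i * real (\<alpha> i))"
    have "(\<integral>\<^sup>+ \<alpha>. ennreal (exp (\<Sum>i\<in>UNIV. \<theta> $ i * real (\<alpha> i))) \<partial>coeff_measure c)
        = (\<integral>\<^sup>+ \<alpha>. ennreal (c \<alpha>) * ennreal (exp (\<Sum>i\<in>UNIV. \<theta> $ i * real (\<alpha> i))) \<partial>count_space UNIV)"
      unfolding coeff_measure_def point_measure_def by (rule nn_integral_density) simp_all
    also have "\<dots> = (\<integral>\<^sup>+ \<alpha>. ennreal (norm (?f \<alpha>)) \<partial>count_space UNIV)"
    proof (rule nn_integral_cong)
      fix \<alpha>
      have "norm (?f \<alpha>) = c \<alpha> * exp (\<Sum>i\<in>UNIV. \<theta> $ i * real (\<alpha> i))"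
        using assms[of \<alpha>] by (simp only: real_norm_def abs_mult abs_of_nonneg abs_exp_cancel)
      then show "ennreal (c \<alpha>) * ennreal (exp (\<Sum>i\<in>UNIV. \<theta> $ i * real (\<alpha> i))) = ennreal (norm (?f \<alpha>))"
        using assms[of \<alpha>] by (simp only: ennreal_mult exp_ge_zero)
    qed
    also have "\<dots> < \<infinity> \<longleftrightarrow> integrable (count_space UNIV) ?f"
      by (simp only: integrable_iff_bounded measurable_count_space_eq1 space_borel UNIV_I Pi_UNIV simp_thms)
    also have "\<dots> \<longleftrightarrow> ?f summable_on UNIV"
      unfolding summable_on_iff_abs_summable_on_real[of ?f] abs_summable_equivalent
        Infinite_Set_Sum.abs_summable_on_def ..
    finally show ?thesis .
  qed
  then show ?thesis
    by (simp add: laplace_domain_def)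
qed

definition sum_zero_hyperplane :: "(real ^ 'n) set" where
  "sum_zero_hyperplane = {s. (\<Sum>i\<in>UNIV. s $ i) = 0}"

definition coord_mean :: "real ^ 'n \<Rightarrow> real" where
  "coord_mean \<theta> = (\<Sum>i\<in>UNIV. \<theta> $ i) / real CARD('n)"

definition ray_poly :: "(real ^ 'n \<Rightarrow> real) \<Rightarrow> real ^ 'n \<Rightarrow> real \<Rightarrow> real" where
  "ray_poly A s t = A (\<chi> i. t * exp (s $ i))"

text \<open>Unspecified when \<^term>\<open>ray_poly A s\<close> has no smallest positive zero.\<close>

definition smallest_pos_zero :: "(real ^ 'n \<Rightarrow> real) \<Rightarrow> real ^ 'n \<Rightarrow> real" where
  "smallest_pos_zero A s = (LEAST t. 0 < t \<and> ray_poly A s t = 0)"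

end

theory Submission
  imports Defs "HOL-Complex_Analysis.Cauchy_Integral_Formula"
begin

text \<open>
  Fix \<open>\<theta>\<close> and write \<open>R \<theta>\<close> for the smallest positive zero of \<open>t \<mapsto> A (t e\<^sup>\<theta>)\<close>. Restricted to the ray \<open>t e\<^sup>\<theta>\<close>, the Taylor
  series of \<open>A powr - lam\<close> is a series in \<open>t\<close> with positive coefficients representing a negative power of
  a real polynomial. By Pringsheim's principle such a series converges up to its first
  positive singularity, and the first singularity of that power is the first zero of the polynomial. As the sum
  tends to infinity there, the series diverges at the zero and beyond. A zero exists because
  the sum increases: without one the polynomial would be bounded and nonconstant. This is
  \<open>nonneg_poly_powr_series_blows_up_at_least_zero\<close>; it gives
  \<open>\<theta> + x (1, \<dots>, 1) \<in> D \<longleftrightarrow> x < ln (R \<theta>)\<close> for every \<open>\<theta>\<close> (\<open>laplace_domain_on_diagonal_lines\<close>), and hence the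
  membership criterion.

  The topological claims follow from this equivalence and the fact that \<open>D\<close> is closed under decreasing
  coordinates. The function \<open>L = ln \<circ> R\<close> satisfies \<open>L (\<theta> + y (1, \<dots>, 1)) = L \<theta> - y\<close> and is antitone, and these two
  properties force it to be 1-Lipschitz (\<open>diagonal_height_lipschitz\<close>). So \<open>D = {L > 0}\<close> is open,
  its boundary is \<open>{L = 0}\<close>, and the latter is the graph of the continuous function \<open>L\<close> over the
  hyperplane in the diagonal direction (\<open>homeomorphism_hyperplane_frontier\<close>).
\<close>

section \<open>Nonnegative series and analytic continuation\<close>

text \<open>
  Re-expanding a series with nonnegative terms about a point \<open>x0\<close> is only controlled to the right of
  \<open>x0\<close>, so uniqueness of coefficients is needed from agreement on a one-sided interval. It holds
  because the zeros of a nonzero power series do not accumulate at its centre.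
\<close>

lemma power_series_coeffs_unique_right:
  fixes a b :: "nat \<Rightarrow> real"
  assumes "\<epsilon> > 0"
    and a: "\<And>u. 0 \<le> u \<Longrightarrow> u < \<epsilon> \<Longrightarrow> (\<lambda>m. a m * u ^ m) sums f u"
    and b: "\<And>u. 0 \<le> u \<Longrightarrow> u < \<epsilon> \<Longrightarrow> (\<lambda>m. b m * u ^ m) sums f u"
  shows "a = b"
proof -
  define d where "d m = a m - b m" for m
  have d0: "(\<lambda>m. d m * u ^ m) sums 0" if "0 \<le> u" "u < \<epsilon>" for u
    using sums_diff[OF a[OF that] b[OF that]] by (simp add: d_def algebra_simps)
  define h where "h u = (\<Sum>m. d m * u ^ m)" for u
  have h0: "h u = 0" if "0 \<le> u" "u < \<epsilon>" for u
    using d0[OF that] by (simp add: h_def sums_iff)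
  have h: "(\<lambda>m. d m * (u - 0) ^ m) sums h u" if "norm (u - 0) < \<epsilon>" for u
  proof -
    obtain v where v: "norm u < v" "v < \<epsilon>"
      using \<open>norm (u - 0) < \<epsilon>\<close> dense[of "norm u" \<epsilon>] by auto
    then have "v \<ge> 0"
      using norm_ge_zero[of u] by linarith
    then have "summable (\<lambda>m. d m * v ^ m)"
      using d0[of v] v by (simp add: sums_iff)
    then have "summable (\<lambda>m. d m * u ^ m)"
      by (rule powser_inside) (use v in auto)
    then show ?thesis
      by (simp add: h_def summable_sums)
  qed
  have "d m = 0" for m
  proof (cases "m = 0")
    case True
    have "(\<lambda>m. d m * 0 ^ m) sums d 0"
      using powser_sums_zero[of d] by simp
    with d0[of 0] \<open>\<epsilon> > 0\<close> True show ?thesis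
      using sums_unique2 by force
  next
    case False
    show ?thesis
    proof (rule ccontr)
      assume "d m \<noteq> 0"
      then obtain s where s: "0 < s" "\<And>z. z \<in> cball 0 s - {0} \<Longrightarrow> h z \<noteq> 0"
        using powser_0_nonzero[OF \<open>\<epsilon> > 0\<close> h, of m] False h0[of 0] \<open>\<epsilon> > 0\<close> by auto
      have "h (min s (\<epsilon> / 2)) \<noteq> 0"
        using s(1) \<open>\<epsilon> > 0\<close> by (intro s(2)) (auto simp: dist_norm)
      moreover have "h (min s (\<epsilon> / 2)) = 0"
        using s(1) \<open>\<epsilon> > 0\<close> by (intro h0) linarith+
      ultimately show False ..
    qed
  qed
  then show ?thesis
    by (auto simp: d_def)
qed

text \<open>
  Pringsheim's principle: if the terms are nonnegative, the series converges as far to the right of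
  \<open>x0\<close> as the power series of its sum at \<open>x0\<close> does. Expanding each \<open>(x0 + u) ^ deg i\<close> binomially gives a
  double series of nonnegative terms, which may be summed in either order. Summed over \<open>i\<close> first, it
  is a power series in \<open>u\<close>, which by uniqueness is the one of \<open>g\<close> at \<open>x0\<close>; for any \<open>u\<close> where the latter
  converges, summing over the powers of \<open>u\<close> first gives back the original series. The index
  type is left arbitrary, so that a multivariate series restricted to a ray needs no regrouping by
  degree.
\<close>

lemma nonneg_series_extends_with_analytic_sum:
  fixes w :: "'i \<Rightarrow> real" and deg :: "'i \<Rightarrow> nat" and g :: "real \<Rightarrow> real"
  assumes w: "\<And>i. w i \<ge> 0" and x0: "x0 \<ge> 0" and \<epsilon>: "0 < \<epsilon>" "\<epsilon> \<le> r"
    and near: "\<And>u. 0 \<le> u \<Longrightarrow> u < \<epsilon> \<Longrightarrow> ((\<lambda>i. w i * (x0 + u) ^ deg i) has_sum g (x0 + u)) UNIV"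
    and ser: "\<And>u. 0 \<le> u \<Longrightarrow> u < r \<Longrightarrow> (\<lambda>m. b m * u ^ m) sums g (x0 + u)"
    and u: "0 \<le> u" "u < r"
  shows "((\<lambda>i. w i * (x0 + u) ^ deg i) has_sum g (x0 + u)) UNIV"
proof -
  define T where "T i m = w i * of_nat (deg i choose m) * x0 ^ (deg i - m)" for i m
  have T_nonneg: "T i m \<ge> 0" for i m
    using w[of i] x0 by (simp add: T_def)
  have row: "((\<lambda>m. T i m * v ^ m) has_sum w i * (x0 + v) ^ deg i) UNIV" for i v
  proof (rule has_sum_finite_neutralI[of "{..deg i}"])
    show "w i * (x0 + v) ^ deg i = (\<Sum>m\<le>deg i. T i m * v ^ m)"
      by (subst add.commute, subst binomial_ring)
         (simp add: T_def sum_distrib_left mult_ac)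
  qed (auto simp: T_def)
  define e where "e m = (\<Sum>\<^sub>\<infinity>i. T i m)" for m
  have double: "((\<lambda>(i, m). T i m * v ^ m) has_sum g (x0 + v)) (UNIV \<times> UNIV)"
    if "0 \<le> v" "v < \<epsilon>" for v
  proof (rule has_sum_SigmaI)
    show "(\<lambda>(i, m). T i m * v ^ m) summable_on UNIV \<times> UNIV"
      by (rule summable_on_SigmaI[where g = "\<lambda>i. w i * (x0 + v) ^ deg i"])
         (use row near[OF that] that T_nonneg in \<open>auto simp: summable_on_def\<close>)
  qed (use row near[OF that] in auto)
  have double_swapped: "((\<lambda>(m, i). T i m * v ^ m) has_sum g (x0 + v)) (UNIV \<times> UNIV)"
    if "0 \<le> v" "v < \<epsilon>" for v
    using double[OF that] by (subst (asm) has_sum_swap) simp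
  have col_summable: "(\<lambda>i. T i m) summable_on UNIV" for m
  proof -
    have "(\<lambda>(m, i). T i m * (\<epsilon> / 2) ^ m) summable_on UNIV \<times> UNIV"
      using double_swapped[of "\<epsilon> / 2"] \<epsilon> by (auto simp: summable_on_def)
    then have "(\<lambda>i. T i m * (\<epsilon> / 2) ^ m) summable_on UNIV"
      by (rule summable_on_SigmaD1) auto
    then show ?thesis
      using \<epsilon> summable_on_cmult_right'[of "(\<epsilon> / 2) ^ m" "\<lambda>i. T i m" UNIV]
      by (simp add: mult.commute)
  qed
  have col: "((\<lambda>i. T i m * v ^ m) has_sum e m * v ^ m) UNIV" for m v
    unfolding e_def by (intro has_sum_cmult_left has_sum_infsum col_summable)
  have e_nonneg: "e m \<ge> 0" for m
    unfolding e_def by (rule infsum_nonneg) (rule T_nonneg)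
  \<comment> \<open>Once the column sums are known to be the given coefficients, \<open>u\<close> may range up to \<open>r\<close>.\<close>
  have "e = b"
  proof (rule power_series_coeffs_unique_right[OF \<open>\<epsilon> > 0\<close>, of _ "\<lambda>u. g (x0 + u)"])
    fix v assume v: "0 \<le> v" "v < \<epsilon>"
    have "((\<lambda>m. e m * v ^ m) has_sum g (x0 + v)) UNIV"
      using double_swapped[OF v] by (rule has_sum_SigmaD) (use col in auto)
    then show "(\<lambda>m. e m * v ^ m) sums g (x0 + v)"
      by (rule has_sum_imp_sums)
  qed (use ser \<epsilon> in auto)
  then have "((\<lambda>m. e m * u ^ m) has_sum g (x0 + u)) UNIV"
    using ser[OF u] e_nonneg u by (intro sums_nonneg_imp_has_sum) auto
  then have "((\<lambda>(m, i). T i m * u ^ m) has_sum g (x0 + u)) (UNIV \<times> UNIV)"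
  proof (rule has_sum_SigmaI[rotated])
    show "(\<lambda>(m, i). T i m * u ^ m) summable_on UNIV \<times> UNIV"
      by (rule summable_on_SigmaI[where g = "\<lambda>m. e m * u ^ m"])
         (use col \<open>((\<lambda>m. e m * u ^ m) has_sum g (x0 + u)) UNIV\<close> u T_nonneg
           in \<open>auto simp: summable_on_def\<close>)
  qed (use col in auto)
  then have "((\<lambda>(i, m). T i m * u ^ m) has_sum g (x0 + u)) (UNIV \<times> UNIV)"
    by (subst (asm) has_sum_swap) simp
  then show ?thesis
    by (rule has_sum_SigmaD) (use row in auto)
qed

section \<open>A nonnegative expansion of a power of a polynomial\<close>

text \<open>
  Near a point where \<open>p\<close> is positive, the complex polynomial has positive real part on a disc, hence
  the principal branch of its power is holomorphic there. Halving the radius of that disc makes one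
  \<open>\<delta>\<close> serve all centres close to \<open>T\<close>; this uniformity is what lets an expansion about a point to the left
  of \<open>T\<close> reach beyond \<open>T\<close>.
\<close>

lemma poly_powr_local_power_series:
  fixes p :: "real poly"
  assumes "poly p T > 0"
  obtains \<delta> where "\<delta> > 0"
    "\<And>x0. \<bar>x0 - T\<bar> < \<delta> \<Longrightarrow> \<exists>b. \<forall>u. \<bar>u\<bar> < \<delta> \<longrightarrow>
       poly p (x0 + u) > 0 \<and> (\<lambda>m. b m * u ^ m) sums (poly p (x0 + u) powr a)"
proof -
  define q :: "complex poly" where "q = map_poly of_real p"
  have q: "poly q (of_real x) = of_real (poly p x)" for x
    unfolding q_def by (induction p) (auto simp: map_poly_pCons)
  have "open ((\<lambda>z. Re (poly q z)) -` {0<..})"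
    by (intro open_vimage continuous_intros)
  moreover have "of_real T \<in> (\<lambda>z. Re (poly q z)) -` {0<..}"
    using assms by (simp add: q)
  ultimately obtain \<rho> where "\<rho> > 0" and \<rho>: "ball (of_real T) \<rho> \<subseteq> (\<lambda>z. Re (poly q z)) -` {0<..}"
    by (meson openE)
  define \<delta> where "\<delta> = \<rho> / 2"
  show thesis
  proof (rule that[of \<delta>])
    show "\<delta> > 0" using \<open>\<rho> > 0\<close> by (simp add: \<delta>_def)
    fix x0 assume x0: "\<bar>x0 - T\<bar> < \<delta>"
    have Re_pos: "Re (poly q z) > 0" if "z \<in> ball (of_real x0) \<delta>" for z
    proof -
      have "dist (of_real T) (of_real x0 :: complex) < \<delta>"
        using x0 by (simp add: dist_norm norm_minus_commute flip: of_real_diff)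
      then have "dist (of_real T) z < \<rho>"
        using that dist_triangle[of "of_real T" z "of_real x0"] by (auto simp: \<delta>_def)
      then show ?thesis using \<rho> by auto
    qed
    define h where "h z = poly q z powr of_real a" for z
    have holo: "h holomorphic_on ball (of_real x0) \<delta>"
      unfolding h_def
    proof (intro holomorphic_intros)
      fix z assume "z \<in> ball (complex_of_real x0) \<delta>"
      from Re_pos[OF this] show "poly q z \<notin> \<real>\<^sub>\<le>\<^sub>0"
        by (auto simp: complex_nonpos_Reals_iff)
    qed
    define b where "b m = Re ((deriv ^^ m) h (of_real x0) / fact m)" for m
    have "poly p (x0 + u) > 0 \<and> (\<lambda>m. b m * u ^ m) sums (poly p (x0 + u) powr a)" if "\<bar>u\<bar> < \<delta>" for u
    proof
      have mem: "of_real (x0 + u) \<in> ball (complex_of_real x0) \<delta>"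
        using that by (simp add: dist_norm flip: of_real_diff)
      show pos: "poly p (x0 + u) > 0"
        using Re_pos[OF mem] by (simp only: q Re_complex_of_real)
      have "(\<lambda>m. Re ((deriv ^^ m) h (of_real x0) / fact m * (of_real (x0 + u) - of_real x0) ^ m))
              sums Re (h (of_real (x0 + u)))"
        by (intro sums_Re holomorphic_power_series[OF holo mem])
      moreover have "Re (c * (of_real (x0 + u) - of_real x0) ^ m) = Re c * u ^ m" for c m
        by (simp flip: of_real_power)
      moreover have "h (of_real (x0 + u)) = of_real (poly p (x0 + u) powr a)"
        unfolding h_def q using pos by (simp add: powr_of_real)
      ultimately show "(\<lambda>m. b m * u ^ m) sums (poly p (x0 + u) powr a)"
        by (simp only: b_def Re_complex_of_real)
    qed
    then show "\<exists>b. \<forall>u. \<bar>u\<bar> < \<delta> \<longrightarrow>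
       poly p (x0 + u) > 0 \<and> (\<lambda>m. b m * u ^ m) sums (poly p (x0 + u) powr a)"
      by blast
  qed
qed

lemma bounded_on_halfline_imp_constant_poly:
  fixes p :: "real poly"
  assumes "\<And>t. t > 0 \<Longrightarrow> \<bar>poly p t\<bar> \<le> B"
  shows "degree p = 0"
proof (rule ccontr)
  assume "degree p \<noteq> 0"
  then have "filterlim (poly p) at_infinity at_infinity"
    by (intro filterlim_poly_at_infinity) auto
  then have "filterlim (poly p) at_infinity at_top"
    using filterlim_mono[OF _ order_refl at_top_le_at_infinity] by blast
  then have "eventually (\<lambda>t. norm (poly p t) \<ge> max 1 (B + 1)) at_top"
    unfolding filterlim_at_infinity[OF order_refl] by (metis less_max_iff_disj zero_less_one)
  then obtain t where "t > 0" "norm (poly p t) \<ge> max 1 (B + 1)"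
    using eventually_conj[OF _ eventually_gt_at_top[of 0]] eventually_happens[of _ "at_top :: real filter"]
    by force
  with assms[of t] show False by auto
qed

text \<open>
  Let \<open>R\<close> be the infimum of the \<open>t \<ge> 0\<close> at which the polynomial fails to be positive or the series fails
  to represent its power. Such \<open>t\<close> exist: otherwise the increasing sum would keep \<open>p\<close> in \<open>(0, 1]\<close>, so \<open>p\<close>
  would be constant, whereas the term of degree one makes the sum grow strictly. If \<open>p R > 0\<close>, Pringsheim's principle
  would carry the representation past \<open>R\<close>; hence \<open>p R = 0\<close>. At \<open>R\<close> itself the series diverges, since
  a finite value would bound the sums to the left of \<open>R\<close>, which tend to infinity.
\<close>

lemma nonneg_poly_powr_series_blows_up_at_least_zero:
  fixes p :: "real poly" and w :: "'i \<Rightarrow> real" and deg :: "'i \<Rightarrow> nat"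
  assumes "lam > 0" and p0: "poly p 0 = 1"
    and w: "\<And>i. w i \<ge> 0" and i1: "deg i1 = 1" "w i1 > 0"
    and "\<epsilon> > 0"
    and near: "\<And>t. 0 \<le> t \<Longrightarrow> t < \<epsilon> \<Longrightarrow>
                 ((\<lambda>i. w i * t ^ deg i) has_sum poly p t powr (- lam)) UNIV"
  obtains R where "R > 0" "poly p R = 0" "\<And>t. 0 < t \<Longrightarrow> poly p t = 0 \<Longrightarrow> R \<le> t"
    "\<And>t. 0 < t \<Longrightarrow> (\<lambda>i. w i * t ^ deg i) summable_on UNIV \<longleftrightarrow> t < R"
proof -
  define good where "good t \<longleftrightarrow> poly p t > 0 \<and>
    ((\<lambda>i. w i * t ^ deg i) has_sum poly p t powr (- lam)) UNIV" for t
  have "open (poly p -` {0<..})"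
    by (intro open_vimage continuous_intros)
  moreover have "0 \<in> poly p -` {0<..}" using p0 by simp
  ultimately obtain \<eta> where "\<eta> > 0" and \<eta>: "ball 0 \<eta> \<subseteq> poly p -` {0<..}"
    by (meson openE)
  have good_small: "good t" if "0 \<le> t" "t < min \<epsilon> \<eta>" for t
    using that near[of t] subsetD[OF \<eta>, of t] by (simp add: good_def)
  have lower: "poly p t powr (- lam) \<ge> 1 + w i1 * t" if "good t" "t \<ge> 0" for t
  proof -
    \<comment> \<open>At \<open>t = 0\<close> only the terms of degree zero remain; subtracting them isolates the growth.\<close>
    have "((\<lambda>i. w i * 0 ^ deg i) has_sum 1) UNIV"
      using good_small[of 0] \<open>\<epsilon> > 0\<close> \<open>\<eta> > 0\<close> p0 by (simp add: good_def)
    then have "((\<lambda>i. w i * t ^ deg i + - (w i * 0 ^ deg i)) has_sum poly p t powr (- lam) + - 1) UNIV"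
      using that by (intro has_sum_add) (simp_all add: good_def has_sum_uminus)
    then have "((\<lambda>i. w i * t ^ deg i - w i * 0 ^ deg i) has_sum poly p t powr (- lam) - 1) UNIV"
      by simp
    then have "sum (\<lambda>i. w i * t ^ deg i - w i * 0 ^ deg i) {i1} \<le> poly p t powr (- lam) - 1"
    proof (rule finite_sum_le_has_sum)
      fix i show "w i * t ^ deg i - w i * 0 ^ deg i \<ge> 0"
        using w[of i] \<open>t \<ge> 0\<close> by (cases "deg i = 0") (auto simp: zero_power)
    qed auto
    then show ?thesis using i1 by simp
  qed
  have "\<exists>t\<ge>0. \<not> good t"
  proof (rule ccontr)
    assume "\<not> (\<exists>t\<ge>0. \<not> good t)"
    then have all: "good t" if "t \<ge> 0" for t using that by blast
    have "\<bar>poly p t\<bar> \<le> 1" if "t > 0" for t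
    proof (rule ccontr)
      assume "\<not> \<bar>poly p t\<bar> \<le> 1"
      moreover have "poly p t > 0" using all[of t] that by (simp add: good_def)
      ultimately have "poly p t powr (- lam) < 1"
        using \<open>lam > 0\<close> powr_less_mono[of "- lam" 0 "poly p t"] by auto
      moreover have "w i1 * t > 0" using i1 that by simp
      ultimately show False using lower[of t] all[of t] that by auto
    qed
    then have "degree p = 0" by (rule bounded_on_halfline_imp_constant_poly)
    then have "poly p 1 = 1" using p0 by (auto elim!: degree_eq_zeroE)
    with lower[of 1] all[of 1] i1 show False by auto
  qed
  define Bad where "Bad = {t. t \<ge> 0 \<and> \<not> good t}"
  have Bad_ne: "Bad \<noteq> {}" using \<open>\<exists>t\<ge>0. \<not> good t\<close> by (auto simp: Bad_def)
  have bdd: "bdd_below Bad" by (auto simp: Bad_def)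
  define R where "R = Inf Bad"
  have R_ge: "R \<ge> x" if "\<And>t. 0 \<le> t \<Longrightarrow> t < x \<Longrightarrow> good t" for x
    unfolding R_def by (rule cInf_greatest[OF Bad_ne]) (use that in \<open>force simp: Bad_def\<close>)
  have good_below: "good t" if "0 \<le> t" "t < R" for t
    using cInf_lower[OF _ bdd, of t] that by (auto simp: Bad_def R_def)
  have "R \<ge> min \<epsilon> \<eta>" by (rule R_ge) (rule good_small)
  then have "R > 0" using \<open>\<epsilon> > 0\<close> \<open>\<eta> > 0\<close> by linarith
  have lim: "(poly p \<longlongrightarrow> poly p R) (at_left R)"
    by (meson poly_isCont isCont_def filterlim_at_split)
  have ev: "eventually (\<lambda>t. t \<in> {0<..<R}) (at_left R)"
    using \<open>R > 0\<close> by (rule eventually_at_left_real)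
  have "poly p R \<ge> 0"
    by (rule tendsto_lowerbound[OF lim])
       (use ev good_below in \<open>auto elim!: eventually_mono simp: good_def less_imp_le\<close>)
  have pR: "poly p R = 0"
  proof (rule ccontr)
    assume "poly p R \<noteq> 0"
    with \<open>poly p R \<ge> 0\<close> have "poly p R > 0" by simp
    then obtain \<delta> where \<delta>: "\<delta> > 0" "\<And>x0. \<bar>x0 - R\<bar> < \<delta> \<Longrightarrow> \<exists>b. \<forall>u. \<bar>u\<bar> < \<delta> \<longrightarrow>
       poly p (x0 + u) > 0 \<and> (\<lambda>m. b m * u ^ m) sums (poly p (x0 + u) powr (- lam))"
      using poly_powr_local_power_series by metis
    \<comment> \<open>A centre so close to \<open>R\<close> that its disc of radius \<open>\<delta>\<close> contains \<open>R\<close>.\<close>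
    define x0 where "x0 = max 0 (R - \<delta> / 2)"
    have x0: "x0 \<ge> 0" "x0 < R" "R - x0 \<le> \<delta> / 2" "\<bar>x0 - R\<bar> < \<delta>"
      using \<open>R > 0\<close> \<open>\<delta> > 0\<close> by (auto simp: x0_def max_def)
    obtain b where b: "\<And>u. \<bar>u\<bar> < \<delta> \<Longrightarrow> poly p (x0 + u) > 0"
      "\<And>u. \<bar>u\<bar> < \<delta> \<Longrightarrow> (\<lambda>m. b m * u ^ m) sums (poly p (x0 + u) powr (- lam))"
      using \<delta>(2)[OF x0(4)] by blast
    have "good (x0 + u)" if "0 \<le> u" "u < \<delta>" for u
    proof -
      have "((\<lambda>i. w i * (x0 + u) ^ deg i) has_sum poly p (x0 + u) powr (- lam)) UNIV"
      proof (rule nonneg_series_extends_with_analytic_sum[where \<epsilon> = "R - x0" and r = \<delta> and b = b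
              and g = "\<lambda>x. poly p x powr (- lam)"])
        fix v assume "0 \<le> v" "v < R - x0"
        then show "((\<lambda>i. w i * (x0 + v) ^ deg i) has_sum poly p (x0 + v) powr (- lam)) UNIV"
          using good_below[of "x0 + v"] x0 by (simp add: good_def)
      qed (use w x0 b that \<open>\<delta> > 0\<close> in auto)
      then show ?thesis using b(1)[of u] that by (simp add: good_def)
    qed
    from this[of "t - x0" for t] have "good t" if "0 \<le> t" "t < x0 + \<delta>" for t
      using that good_below[of t] x0 by (cases "t < R") auto
    then have "x0 + \<delta> \<le> R" by (rule R_ge)
    with x0 \<open>\<delta> > 0\<close> show False by linarith
  qed
  have not_at_R: "\<not> (\<lambda>i. w i * R ^ deg i) summable_on UNIV"
  proof
    assume "(\<lambda>i. w i * R ^ deg i) summable_on UNIV"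
    then obtain M where M: "((\<lambda>i. w i * R ^ deg i) has_sum M) UNIV"
      by (auto simp: summable_on_def)
    have le: "poly p t powr (- lam) \<le> M" if "0 < t" "t < R" for t
      using good_below[of t] that M w
      by (auto simp: good_def intro!: has_sum_mono[OF _ M] mult_left_mono power_mono)
    have "M > 0"
      using le[of "R / 2"] good_below[of "R / 2"] \<open>R > 0\<close>
      by (auto simp: good_def intro: less_le_trans[OF _ le[of "R / 2"]])
    have "poly p t \<ge> M powr (- 1 / lam)" if "0 < t" "t < R" for t
    proof -
      have "M powr (- 1 / lam) \<le> (poly p t powr (- lam)) powr (- 1 / lam)"
        using le[OF that] good_below[of t] that \<open>lam > 0\<close>
        by (intro powr_mono2') (auto simp: good_def)
      also have "\<dots> = poly p t"
        using good_below[of t] that \<open>lam > 0\<close> by (simp add: powr_powr good_def)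
      finally show ?thesis .
    qed
    then have "poly p R \<ge> M powr (- 1 / lam)"
      by (intro tendsto_lowerbound[OF lim]) (use ev in \<open>auto elim!: eventually_mono\<close>)
    with pR \<open>M > 0\<close> show False by simp
  qed
  show thesis
  proof (rule that[of R])
    show "R \<le> t" if "0 < t" "poly p t = 0" for t
      using good_below[of t] that by (force simp: good_def)
    show "(\<lambda>i. w i * t ^ deg i) summable_on UNIV \<longleftrightarrow> t < R" if "0 < t" for t
    proof
      assume "t < R"
      with good_below[of t] that show "(\<lambda>i. w i * t ^ deg i) summable_on UNIV"
        by (auto simp: good_def summable_on_def)
    next
      assume sum: "(\<lambda>i. w i * t ^ deg i) summable_on UNIV"
      show "t < R"
      proof (rule ccontr)
        assume "\<not> t < R"
        then have "(\<lambda>i. w i * R ^ deg i) summable_on UNIV"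
          using w \<open>R > 0\<close>
          by (intro summable_on_comparison_test[OF sum]) (auto intro!: mult_left_mono power_mono)
        with not_at_R show False by blast
      qed
    qed
  qed fact+
qed

section \<open>The Laplace domain along diagonal lines\<close>

lemma ray_poly_is_poly:
  assumes "affine_polynomial A"
  obtains p where "\<And>t. poly p t = ray_poly A \<theta> t"
proof -
  obtain a where a: "\<And>z. A z = (\<Sum>T\<in>UNIV. a T * (\<Prod>i\<in>T. z $ i))"
    using assms by (auto simp: affine_polynomial_def)
  show thesis
    by (rule that[of "\<Sum>T\<in>UNIV. monom (a T * (\<Prod>i\<in>T. exp (\<theta> $ i))) (card T)"])
       (simp add: ray_poly_def a poly_sum poly_monom prod.distrib mult_ac)
qed

lemma monomial_on_ray:
  fixes \<theta> :: "real ^ 'n"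
  shows "c * (\<Prod>i\<in>UNIV. (t * exp (\<theta> $ i)) ^ \<alpha> i) =
    c * exp (\<Sum>i\<in>UNIV. \<theta> $ i * real (\<alpha> i)) * t ^ (\<Sum>i\<in>UNIV. \<alpha> i)"
  by (simp add: power_mult_distrib prod.distrib power_sum exp_sum mult_ac flip: exp_of_nat_mult)

lemma taylor_expansion_on_ray:
  fixes \<theta> :: "real ^ 'n"
  assumes "has_taylor_expansion (\<lambda>z. A z powr a) c"
  obtains \<epsilon> where "\<epsilon> > 0"
    "\<And>t. 0 \<le> t \<Longrightarrow> t < \<epsilon> \<Longrightarrow> ((\<lambda>\<alpha>. c \<alpha> * exp (\<Sum>i\<in>UNIV. \<theta> $ i * real (\<alpha> i)) * t ^ (\<Sum>i\<in>UNIV. \<alpha> i))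
       has_sum ray_poly A \<theta> t powr a) UNIV"
proof -
  obtain d where d: "d > 0" "\<And>z. norm z < d \<Longrightarrow>
      ((\<lambda>\<alpha>. c \<alpha> * (\<Prod>i\<in>UNIV. z $ i ^ \<alpha> i)) has_sum A z powr a) UNIV"
    using assms by (auto simp: has_taylor_expansion_def eventually_nhds_metric)
  define v :: "real ^ 'n" where "v = (\<chi> i. exp (\<theta> $ i))"
  have pos: "norm v + 1 > 0" using norm_ge_zero[of v] by linarith
  show thesis
  proof (rule that[of "d / (norm v + 1)"])
    show "d / (norm v + 1) > 0" using d(1) pos by simp
    fix t assume t: "0 \<le> t" "t < d / (norm v + 1)"
    have "t * norm v \<le> t * (norm v + 1)" using t by (intro mult_left_mono) auto
    also have "\<dots> < d" using t pos by (simp add: field_simps)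
    finally have "norm (t *\<^sub>R v) < d" using t by simp
    moreover have "t *\<^sub>R v = (\<chi> i. t * exp (\<theta> $ i))" by (simp add: v_def vec_eq_iff)
    ultimately have "norm (\<chi> i. t * exp (\<theta> $ i)) < d" by simp
    from d(2)[OF this] show "((\<lambda>\<alpha>. c \<alpha> * exp (\<Sum>i\<in>UNIV. \<theta> $ i * real (\<alpha> i)) * t ^ (\<Sum>i\<in>UNIV. \<alpha> i))
       has_sum ray_poly A \<theta> t powr a) UNIV"
      by (simp add: monomial_on_ray ray_poly_def)
  qed
qed

text \<open>
  Moving \<open>\<theta>\<close> by \<open>x\<close> in the diagonal direction multiplies the term of index \<open>\<alpha>\<close> by the power \<open>exp x ^ |\<alpha>|\<close>, so
  the question is the convergence of a one-variable series at \<open>t = exp x\<close>, with \<open>|\<alpha>|\<close> as degree. The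
  statements hold for all \<open>\<theta>\<close>, on the hyperplane or off it; this freedom makes the logarithm of the zero a
  function on the whole space, to which monotonicity arguments apply.
\<close>

lemma laplace_domain_on_diagonal_lines:
  fixes A :: "real ^ 'n \<Rightarrow> real" and \<theta> :: "real ^ 'n"
  assumes "affine_polynomial A" "lam > 0" "A 0 = 1"
    and taylor: "has_taylor_expansion (\<lambda>z. A z powr (- lam)) c"
    and c: "\<And>\<alpha>. c \<alpha> > 0"
  shows smallest_pos_zero_pos: "smallest_pos_zero A \<theta> > 0"
    and ray_poly_smallest_pos_zero: "ray_poly A \<theta> (smallest_pos_zero A \<theta>) = 0"
    and smallest_pos_zero_le: "\<And>t. 0 < t \<Longrightarrow> ray_poly A \<theta> t = 0 \<Longrightarrow> smallest_pos_zero A \<theta> \<le> t"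
    and add_vec_mem_laplace_domain_iff: "\<And>x. \<theta> + vec x \<in> laplace_domain (coeff_measure c) \<longleftrightarrow>
           x < ln (smallest_pos_zero A \<theta>)"
proof -
  define w where "w \<alpha> = c \<alpha> * exp (\<Sum>i\<in>UNIV. \<theta> $ i * real (\<alpha> i))" for \<alpha>
  have w: "w \<alpha> > 0" for \<alpha> using c by (simp add: w_def)
  define deg where "deg \<alpha> = (\<Sum>i\<in>UNIV. \<alpha> i)" for \<alpha> :: "'n \<Rightarrow> nat"
  obtain p where p: "\<And>t. poly p t = ray_poly A \<theta> t"
    using ray_poly_is_poly[OF assms(1)] by blast
  obtain \<epsilon> where \<epsilon>: "\<epsilon> > 0" "\<And>t. 0 \<le> t \<Longrightarrow> t < \<epsilon> \<Longrightarrow>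
      ((\<lambda>\<alpha>. w \<alpha> * t ^ deg \<alpha>) has_sum poly p t powr (- lam)) UNIV"
    using taylor_expansion_on_ray[OF taylor, of \<theta>] unfolding w_def deg_def p by blast
  have "(\<chi> i. 0) = (0 :: real ^ 'n)" by (simp add: vec_eq_iff)
  then have p0: "poly p 0 = 1" using assms(3) by (simp add: p ray_poly_def)
  have deg1: "deg (\<lambda>i. if i = j then 1 else 0) = 1" for j by (simp add: deg_def)
  obtain R where R: "R > 0" "poly p R = 0" "\<And>t. 0 < t \<Longrightarrow> poly p t = 0 \<Longrightarrow> R \<le> t"
    "\<And>t. 0 < t \<Longrightarrow> (\<lambda>\<alpha>. w \<alpha> * t ^ deg \<alpha>) summable_on UNIV \<longleftrightarrow> t < R"
    using nonneg_poly_powr_series_blows_up_at_least_zero[OF \<open>lam > 0\<close> p0 less_imp_le[OF w] deg1 w \<epsilon>]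
    by blast
  have R_eq: "smallest_pos_zero A \<theta> = R"
    unfolding smallest_pos_zero_def by (rule Least_equality) (use R in \<open>auto simp: p\<close>)
  show "smallest_pos_zero A \<theta> > 0" "ray_poly A \<theta> (smallest_pos_zero A \<theta>) = 0"
    "\<And>t. 0 < t \<Longrightarrow> ray_poly A \<theta> t = 0 \<Longrightarrow> smallest_pos_zero A \<theta> \<le> t"
    using R by (auto simp: R_eq p)
  fix x :: real
  have "c \<alpha> * exp (\<Sum>i\<in>UNIV. (\<theta> + vec x) $ i * real (\<alpha> i)) = w \<alpha> * exp x ^ deg \<alpha>" for \<alpha>
    by (simp add: w_def deg_def algebra_simps sum.distrib sum_distrib_left exp_add flip: exp_of_nat_mult)
  then have "\<theta> + vec x \<in> laplace_domain (coeff_measure c) \<longleftrightarrow> exp x < R"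
    unfolding laplace_domain_coeff_measure[OF less_imp_le[OF c]] using R(4)[of "exp x"] by simp
  also have "\<dots> \<longleftrightarrow> x < ln R" using R(1) by (metis exp_less_cancel_iff exp_ln)
  finally show "\<theta> + vec x \<in> laplace_domain (coeff_measure c) \<longleftrightarrow> x < ln (smallest_pos_zero A \<theta>)"
    by (simp add: R_eq)
qed

lemma laplace_domain_downward_closed:
  fixes \<theta> \<theta>' :: "real ^ 'n"
  assumes "\<theta> \<in> laplace_domain \<mu>" "\<And>i. \<theta>' $ i \<le> \<theta> $ i"
  shows "\<theta>' \<in> laplace_domain \<mu>"
proof -
  have "(\<integral>\<^sup>+ \<alpha>. ennreal (exp (\<Sum>i\<in>UNIV. \<theta>' $ i * real (\<alpha> i))) \<partial>\<mu>) \<le>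
        (\<integral>\<^sup>+ \<alpha>. ennreal (exp (\<Sum>i\<in>UNIV. \<theta> $ i * real (\<alpha> i))) \<partial>\<mu>)"
    by (intro nn_integral_mono ennreal_leI) (auto intro!: sum_mono mult_right_mono assms(2))
  with assms(1) show ?thesis
    by (auto simp: laplace_domain_def)
qed

section \<open>Downward closed sets as strict subgraphs over the hyperplane\<close>

lemma coord_mean_add_vec: "coord_mean (\<theta> + vec x) = coord_mean \<theta> + x"
  by (simp add: coord_mean_def sum.distrib add_divide_distrib)

lemma continuous_on_coord_mean: "continuous_on S coord_mean"
  unfolding coord_mean_def[abs_def] by (intro continuous_intros) simp

lemma diff_coord_mean_in_hyperplane: "\<theta> - vec (coord_mean \<theta>) \<in> sum_zero_hyperplane"
  by (simp add: sum_zero_hyperplane_def coord_mean_def sum_subtractf)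

lemma coord_mean_hyperplane: "s \<in> sum_zero_hyperplane \<Longrightarrow> coord_mean s = 0"
  by (simp add: sum_zero_hyperplane_def coord_mean_def)

text \<open>
  \<open>D\<close> meets every diagonal line in an open half-line, and \<open>L \<theta>\<close> is the signed distance from \<open>\<theta>\<close> to its
  end, in units of the diagonal vector \<open>(1, \<dots>, 1)\<close>. Downward closedness
  adds that \<open>L\<close> is continuous, so that the end points form a hypersurface.
\<close>

locale downward_closed_domain =
  fixes D :: "(real ^ 'n) set" and L :: "real ^ 'n \<Rightarrow> real"
  assumes mem_iff: "\<And>\<theta> x. \<theta> + vec x \<in> D \<longleftrightarrow> x < L \<theta>"
    and down: "\<And>\<theta> \<theta>'. \<theta> \<in> D \<Longrightarrow> (\<And>i. \<theta>' $ i \<le> \<theta> $ i) \<Longrightarrow> \<theta>' \<in> D"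
begin

lemma diagonal_height_add_vec: "L (\<theta> + vec y) = L \<theta> - y"
proof -
  have *: "x < L (\<theta> + vec y) \<longleftrightarrow> x < L \<theta> - y" for x
  proof -
    have "(\<theta> + vec y) + vec x = \<theta> + vec (x + y)" by (simp add: vec_eq_iff)
    then show ?thesis
      by (simp only: less_diff_eq flip: mem_iff)
  qed
  show ?thesis
    using *[of "L (\<theta> + vec y)"] *[of "L \<theta> - y"] by linarith
qed

lemma diagonal_height_antimono:
  assumes "\<And>i. \<theta>' $ i \<le> \<theta> $ i"
  shows "L \<theta> \<le> L \<theta>'"
proof (rule dense_le)
  fix x assume "x < L \<theta>"
  then have "\<theta> + vec x \<in> D" by (simp add: mem_iff)
  then have "\<theta>' + vec x \<in> D" by (rule down) (simp add: assms)
  then show "x \<le> L \<theta>'" by (simp add: mem_iff)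
qed

text \<open>
  Lowering \<open>\<theta>'\<close> by \<open>dist \<theta> \<theta>'\<close> in every coordinate puts it below \<open>\<theta>\<close>, and changes \<open>L\<close> by exactly that
  amount; antitonicity does the rest.
\<close>

lemma diagonal_height_lipschitz: "1-lipschitz_on UNIV L"
proof (rule lipschitz_onI)
  have *: "L \<theta> \<le> L \<theta>' + dist \<theta> \<theta>'" for \<theta> \<theta>'
  proof -
    have "(\<theta>' + vec (- dist \<theta> \<theta>')) $ i \<le> \<theta> $ i" for i
      using component_le_norm_cart[of "\<theta> - \<theta>'" i] by (simp add: dist_norm)
    from diagonal_height_antimono[OF this] show ?thesis
      by (simp only: diagonal_height_add_vec)
  qed
  show "dist (L \<theta>) (L \<theta>') \<le> 1 * dist \<theta> \<theta>'" for \<theta> \<theta>'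
    using *[of \<theta> \<theta>'] *[of \<theta>' \<theta>] by (simp add: dist_real_def dist_commute)
qed simp

lemma continuous_on_diagonal_height: "continuous_on S L"
  using lipschitz_on_continuous_on[OF diagonal_height_lipschitz] continuous_on_subset by blast

lemma domain_eq_pos_diagonal_height: "D = {\<theta>. 0 < L \<theta>}"
  using mem_iff[of _ 0] by (auto simp: vec_eq_iff)

lemma open_domain: "open D"
  unfolding domain_eq_pos_diagonal_height
  by (intro open_Collect_less continuous_on_const continuous_on_diagonal_height)

lemma frontier_domain: "frontier D = {\<theta>. L \<theta> = 0}"
proof -
  have "closure D = {\<theta>. 0 \<le> L \<theta>}"
  proof
    show "closure D \<subseteq> {\<theta>. 0 \<le> L \<theta>}"
      unfolding domain_eq_pos_diagonal_height
      by (intro closure_minimal closed_Collect_le continuous_on_const continuous_on_diagonal_height) auto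
  next
    show "{\<theta>. 0 \<le> L \<theta>} \<subseteq> closure D"
    proof safe
      fix \<theta> assume "0 \<le> L \<theta>"
      \<comment> \<open>Every point with \<open>L \<theta> \<ge> 0\<close> is approached by moving down its diagonal line.\<close>
      have "(\<lambda>k. \<theta> + vec (- inverse (real (Suc k)))) \<longlonglongrightarrow> \<theta> + vec (- 0)"
        unfolding vec_def
        by (intro tendsto_intros LIMSEQ_inverse_real_of_nat)
      moreover have "\<theta> + vec (- inverse (real (Suc k))) \<in> D" for k
        unfolding mem_iff using \<open>0 \<le> L \<theta>\<close> by (rule less_le_trans[rotated]) simp
      ultimately have "\<theta> + vec (- 0) \<in> closure D"
        unfolding closure_sequential
        by (intro exI[of _ "\<lambda>k. \<theta> + vec (- inverse (real (Suc k)))"] conjI allI)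
      then show "\<theta> \<in> closure D" by (simp add: vec_eq_iff)
    qed
  qed
  then have "frontier D = {\<theta>. 0 \<le> L \<theta>} - D"
    by (simp add: frontier_def interior_open[OF open_domain])
  also have "\<dots> = {\<theta>. L \<theta> = 0}"
    by (subst domain_eq_pos_diagonal_height) auto
  finally show ?thesis .
qed

text \<open>
  The boundary is the zero set of \<open>L\<close>, and \<open>L\<close> decreases at unit speed along diagonals, so each diagonal
  line meets the boundary once, at the point obtained by adding \<open>L s\<close> to its point \<open>s\<close> of the
  hyperplane. Subtracting the mean recovers \<open>s\<close>.
\<close>

lemma homeomorphism_hyperplane_frontier:
  "homeomorphism sum_zero_hyperplane (frontier D) (\<lambda>s. s + vec (L s)) (\<lambda>\<theta>. \<theta> - vec (coord_mean \<theta>))"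
proof (rule homeomorphismI)
  show "continuous_on sum_zero_hyperplane (\<lambda>s. s + vec (L s))"
    unfolding vec_def by (intro continuous_intros continuous_on_diagonal_height)
  show "continuous_on (frontier D) (\<lambda>\<theta>. \<theta> - vec (coord_mean \<theta>))"
    unfolding vec_def by (intro continuous_intros continuous_on_coord_mean)
  show "(\<lambda>s. s + vec (L s)) ` sum_zero_hyperplane \<subseteq> frontier D"
    by (auto simp: frontier_domain diagonal_height_add_vec)
  show "(\<lambda>\<theta>. \<theta> - vec (coord_mean \<theta>)) ` frontier D \<subseteq> sum_zero_hyperplane"
    by (auto simp: diff_coord_mean_in_hyperplane)
  show "s + vec (L s) - vec (coord_mean (s + vec (L s))) = s" if "s \<in> sum_zero_hyperplane" for s
    using that by (simp add: coord_mean_add_vec coord_mean_hyperplane)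
  show "\<theta> - vec (coord_mean \<theta>) + vec (L (\<theta> - vec (coord_mean \<theta>))) = \<theta>" if "\<theta> \<in> frontier D" for \<theta>
  proof -
    have "\<theta> - vec (coord_mean \<theta>) = \<theta> + vec (- coord_mean \<theta>)" by (simp add: vec_eq_iff)
    then have "L (\<theta> - vec (coord_mean \<theta>)) = coord_mean \<theta>"
      using that by (simp only: frontier_domain diagonal_height_add_vec mem_Collect_eq)
    then show ?thesis by simp
  qed
qed

end

section \<open>The domain and its boundary\<close>

theorem theorem3:
  fixes A :: "real ^ 'n \<Rightarrow> real"
    and lam :: real
    and c :: "('n \<Rightarrow> nat) \<Rightarrow> real"
  assumes "affine_polynomial A"
    and "lam > 0"
    and "A 0 = 1"
    and "has_taylor_expansion (\<lambda>z. A z powr (- lam)) c"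
    and "\<And>\<alpha>. c \<alpha> > 0"
  defines "D \<equiv> laplace_domain (coeff_measure c)"
    and "H \<equiv> sum_zero_hyperplane"
    and "R \<equiv> smallest_pos_zero A"
  shows "(\<forall>s\<in>H. 0 < R s \<and> ray_poly A s (R s) = 0 \<and> (\<forall>t. 0 < t \<and> ray_poly A s t = 0 \<longrightarrow> R s \<le> t))
    \<and> (\<exists>g. homeomorphism H (frontier D) (\<lambda>s. s + vec (ln (R s))) g)
    \<and> (\<forall>\<theta>. \<theta> \<in> D \<longleftrightarrow> coord_mean \<theta> < ln (R (\<theta> - vec (coord_mean \<theta>))))
    \<and> open D"
proof -
  interpret downward_closed_domain D "\<lambda>s. ln (R s)"
  proof
    show "\<theta> + vec x \<in> D \<longleftrightarrow> x < ln (R \<theta>)" for \<theta> x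
      unfolding D_def R_def by (rule add_vec_mem_laplace_domain_iff[OF assms(1-5)])
    show "\<theta>' \<in> D" if "\<theta> \<in> D" "\<And>i. \<theta>' $ i \<le> \<theta> $ i" for \<theta> \<theta>'
      using that unfolding D_def by (rule laplace_domain_downward_closed)
  qed
  show ?thesis
  proof (intro conjI ballI allI impI)
    fix s
    show "0 < R s" "ray_poly A s (R s) = 0"
      unfolding R_def
      using smallest_pos_zero_pos[OF assms(1-5)] ray_poly_smallest_pos_zero[OF assms(1-5)] by simp_all
    show "R s \<le> t" if "0 < t \<and> ray_poly A s t = 0" for t
      unfolding R_def using that by (intro smallest_pos_zero_le[OF assms(1-5)]) simp_all
  next
    show "\<exists>g. homeomorphism H (frontier D) (\<lambda>s. s + vec (ln (R s))) g"
      unfolding H_def by (rule exI, rule homeomorphism_hyperplane_frontier)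
  next
    fix \<theta>
    show "\<theta> \<in> D \<longleftrightarrow> coord_mean \<theta> < ln (R (\<theta> - vec (coord_mean \<theta>)))"
      using mem_iff[of "\<theta> - vec (coord_mean \<theta>)" "coord_mean \<theta>"] by simp
  next
    show "open D"
      by (rule open_domain)
  qed
qed

end
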